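(* Let $K$ be an arbitrary field, let $A$ be the free metabelian anticommutative algebra over $K$ with free generators $x_1,\ldots,x_n$, and let $f\in A^2$. Then $\frac{\partial f}{\partial x_1}=0$ if and only if $f$ belongs to the ideal of $A$ generated by all products $x_ix_j$ with $i,j>1$.
   Context: Algebras are nonassociative and without required unit. An algebra over $K$ is anticommutative if it satisfies the identity $x^2=0$, and metabelian if it satisfies the identity $(xy)(zt)=0$. $A$ is the free algebra on $x_1,\ldots,x_n$ in the variety defined by these two identities, and $A^2=AA$ is the span of all products. Fox derivatives. Let $Y=A/A^2$, with basis $y_1,\ldots,y_n$ (the images of $x_1,\ldots,x_n$). Let $U$ be the free associative algebra with identity over $K$ on free generators $z_1,\ldots,z_n$, and for $a=\sum_i\alpha_iy_i\in Y$ put $R_a=\sum_i\alpha_iz_i\in U$. Let $T$ be the free right $U$-module with free generators $t_1,\ldots,t_n$. The space $Y\oplus T$ is a metabelian anticommutative algebra under $(a_1+m_1)(a_2+m_2)=m_1R_{a_2}-m_2R_{a_1}$ for $a_1,a_2\in Y$, $m_1,m_2\in T$. The homomorphism $\rho:A\to Y\oplus T$ with $\rho(x_i)=y_i+t_i$ is injective, and $A$ is identified with its image. Each $a\in A$ is then uniquely written as $a=y+t_1u_1+\cdots+t_nu_n$ with $y\in Y$, $u_i\in U$, and one sets $\frac{\partial a}{\partial x_i}=u_i$. *)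

theory Defs
  imports "HOL-Analysis.Cartesian_Space" "HOL-Library.Poly_Mapping"
begin

section \<open>Nonassociative algebras over a field\<close>

text \<open>
  No associativity and no unit are assumed.
\<close>

locale nonassoc_algebra = vector_space scale
  for scale :: "'k::field \<Rightarrow> 'a::ab_group_add \<Rightarrow> 'a" (infixr \<open>\<odot>\<close> 75) +
  fixes mult :: "'a \<Rightarrow> 'a \<Rightarrow> 'a" (infixl \<open>\<cdot>\<close> 70)
  assumes mult_add_left: "(a + b) \<cdot> c = a \<cdot> c + b \<cdot> c"
    and mult_add_right: "a \<cdot> (b + c) = a \<cdot> b + a \<cdot> c"
    and mult_scale_left: "(r \<odot> a) \<cdot> b = r \<odot> (a \<cdot> b)"
    and mult_scale_right: "a \<cdot> (r \<odot> b) = r \<odot> (a \<cdot> b)"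
begin

definition anticommutative :: bool where
  "anticommutative \<longleftrightarrow> (\<forall>x. x \<cdot> x = 0)"

definition metabelian :: bool where
  "metabelian \<longleftrightarrow> (\<forall>x y z t. (x \<cdot> y) \<cdot> (z \<cdot> t) = 0)"

definition square :: "'a set" where
  "square = span {a \<cdot> b | a b. True}"

definition alg_ideal :: "'a set \<Rightarrow> bool" where
  "alg_ideal I \<longleftrightarrow> subspace I \<and> (\<forall>a. \<forall>b\<in>I. a \<cdot> b \<in> I \<and> b \<cdot> a \<in> I)"

definition ideal_generated :: "'a set \<Rightarrow> 'a set" where
  "ideal_generated S = alg_ideal hull S"

lemma mult_zero_left [simp]: "0 \<cdot> a = 0"
  using mult_add_left[of 0 0 a] by simp

lemma mult_zero_right [simp]: "a \<cdot> 0 = 0"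
  using mult_add_right[of a 0 0] by simp

lemma mult_minus_left: "(- a) \<cdot> b = - (a \<cdot> b)"
  using mult_add_left[of a "- a" b] by (simp add: eq_neg_iff_add_eq_0 add.commute)

lemma mult_minus_right: "a \<cdot> (- b) = - (a \<cdot> b)"
  using mult_add_right[of a b "- b"] by (simp add: eq_neg_iff_add_eq_0 add.commute)

lemma mult_diff_left: "(a - b) \<cdot> c = a \<cdot> c - b \<cdot> c"
  using mult_add_left[of a "- b" c] by (simp add: mult_minus_left)

lemma mult_diff_right: "a \<cdot> (b - c) = a \<cdot> b - a \<cdot> c"
  using mult_add_right[of a b "- c"] by (simp add: mult_minus_right)

lemma mult_sum_left: "(\<Sum>i\<in>S. f i) \<cdot> b = (\<Sum>i\<in>S. f i \<cdot> b)"
  by (induction S rule: infinite_finite_induct) (auto simp: mult_add_left)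

lemma mult_sum_right: "b \<cdot> (\<Sum>i\<in>S. f i) = (\<Sum>i\<in>S. b \<cdot> f i)"
  by (induction S rule: infinite_finite_induct) (auto simp: mult_add_right)

lemma alg_ideal_ideal_generated: "alg_ideal (ideal_generated S)"
  unfolding ideal_generated_def
proof (rule hull_in)
  fix T assume T: "Ball T alg_ideal"
  then have "subspace (\<Inter>T)"
    by (intro subspace_Inter) (auto simp: alg_ideal_def)
  with T show "alg_ideal (\<Inter>T)"
    by (auto simp: alg_ideal_def)
qed

lemma ideal_generated_superset: "S \<subseteq> ideal_generated S"
  unfolding ideal_generated_def by (rule hull_subset)

lemma ideal_generated_minimal: "S \<subseteq> I \<Longrightarrow> alg_ideal I \<Longrightarrow> ideal_generated S \<subseteq> I"
  unfolding ideal_generated_def by (rule hull_minimal)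

end

definition alg_hom ::
  "('k::field \<Rightarrow> 'a::ab_group_add \<Rightarrow> 'a) \<Rightarrow> ('a \<Rightarrow> 'a \<Rightarrow> 'a) \<Rightarrow>
   ('k \<Rightarrow> 'b::ab_group_add \<Rightarrow> 'b) \<Rightarrow> ('b \<Rightarrow> 'b \<Rightarrow> 'b) \<Rightarrow> ('a \<Rightarrow> 'b) \<Rightarrow> bool"
  where "alg_hom s1 m1 s2 m2 h \<longleftrightarrow>
    Vector_Spaces.linear s1 s2 h \<and> (\<forall>a b. h (m1 a b) = m2 (h a) (h b))"


section \<open>The free nonassociative algebra\<close>

datatype 'n magma = Gen 'n | Node "'n magma" "'n magma"

definition pm_scale :: "'k::field \<Rightarrow> ('a \<Rightarrow>\<^sub>0 'k) \<Rightarrow> ('a \<Rightarrow>\<^sub>0 'k)" where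
  "pm_scale c p = Poly_Mapping.map ((*) c) p"

lemma lookup_pm_scale [simp]:
  "Poly_Mapping.lookup (pm_scale c p) x = c * Poly_Mapping.lookup p x"
  by (simp add: pm_scale_def Poly_Mapping.map.rep_eq when_def)

lemma vector_space_pm_scale: "vector_space (pm_scale :: 'k::field \<Rightarrow> ('a \<Rightarrow>\<^sub>0 'k) \<Rightarrow> _)"
  by unfold_locales (auto intro!: poly_mapping_eqI simp: lookup_add algebra_simps)

definition free_mult ::
  "('n magma \<Rightarrow>\<^sub>0 'k::field) \<Rightarrow> ('n magma \<Rightarrow>\<^sub>0 'k) \<Rightarrow> ('n magma \<Rightarrow>\<^sub>0 'k)" where
  "free_mult p q = (\<Sum>s\<in>Poly_Mapping.keys p. \<Sum>t\<in>Poly_Mapping.keys q.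
     Poly_Mapping.single (Node s t) (Poly_Mapping.lookup p s * Poly_Mapping.lookup q t))"

lemma free_mult_superset:
  assumes "finite S" "finite T" "Poly_Mapping.keys p \<subseteq> S" "Poly_Mapping.keys q \<subseteq> T"
  shows "free_mult p q = (\<Sum>s\<in>S. \<Sum>t\<in>T.
     Poly_Mapping.single (Node s t) (Poly_Mapping.lookup p s * Poly_Mapping.lookup q t))"
proof -
  have "free_mult p q = (\<Sum>s\<in>Poly_Mapping.keys p. \<Sum>t\<in>T.
     Poly_Mapping.single (Node s t) (Poly_Mapping.lookup p s * Poly_Mapping.lookup q t))"
    unfolding free_mult_def using assms
    by (intro sum.cong refl sum.mono_neutral_left) (auto simp: in_keys_iff)
  also have "\<dots> = (\<Sum>s\<in>S. \<Sum>t\<in>T.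
     Poly_Mapping.single (Node s t) (Poly_Mapping.lookup p s * Poly_Mapping.lookup q t))"
    using assms by (intro sum.mono_neutral_left) (auto simp: in_keys_iff)
  finally show ?thesis .
qed

lemma pm_scale_sum: "pm_scale r (\<Sum>i\<in>S. f i) = (\<Sum>i\<in>S. pm_scale r (f i))"
  by (intro poly_mapping_eqI) (simp add: lookup_sum sum_distrib_left)

lemma pm_scale_single: "pm_scale r (Poly_Mapping.single x c) = Poly_Mapping.single x (r * c)"
  by (auto intro!: poly_mapping_eqI simp: lookup_single when_def)

interpretation free: nonassoc_algebra
  "pm_scale :: 'k::field \<Rightarrow> ('n magma \<Rightarrow>\<^sub>0 'k) \<Rightarrow> _" free_mult
proof (intro nonassoc_algebra.intro vector_space_pm_scale nonassoc_algebra_axioms.intro)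
  fix a b c :: "'n magma \<Rightarrow>\<^sub>0 'k" and r :: 'k
  let ?S = "Poly_Mapping.keys a \<union> Poly_Mapping.keys b \<union> Poly_Mapping.keys c"
  have fin: "finite ?S" by simp
  have ab: "Poly_Mapping.keys (a + b) \<subseteq> ?S" and bc: "Poly_Mapping.keys (b + c) \<subseteq> ?S"
    using keys_add by fastforce+
  have r: "Poly_Mapping.keys (pm_scale r a) \<subseteq> ?S" "Poly_Mapping.keys (pm_scale r b) \<subseteq> ?S"
    by (auto simp: in_keys_iff)
  have s: "Poly_Mapping.keys a \<subseteq> ?S" "Poly_Mapping.keys b \<subseteq> ?S" "Poly_Mapping.keys c \<subseteq> ?S"
    by auto
  note sup = free_mult_superset[OF fin fin]
  show "free_mult (a + b) c = free_mult a c + free_mult b c"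
    unfolding sup[OF ab s(3)] sup[OF s(1) s(3)] sup[OF s(2) s(3)]
    by (simp add: lookup_add algebra_simps single_add sum.distrib)
  show "free_mult a (b + c) = free_mult a b + free_mult a c"
    unfolding sup[OF s(1) bc] sup[OF s(1) s(2)] sup[OF s(1) s(3)]
    by (simp add: lookup_add algebra_simps single_add sum.distrib)
  show "free_mult (pm_scale r a) b = pm_scale r (free_mult a b)"
    unfolding sup[OF r(1) s(2)] sup[OF s(1) s(2)]
    by (simp add: pm_scale_sum pm_scale_single algebra_simps)
  show "free_mult a (pm_scale r b) = pm_scale r (free_mult a b)"
    unfolding sup[OF s(1) r(2)] sup[OF s(1) s(2)]
    by (simp add: pm_scale_sum pm_scale_single algebra_simps)
qed

context nonassoc_algebra
begin

primrec eval_magma :: "('n \<Rightarrow> 'a) \<Rightarrow> 'n magma \<Rightarrow> 'a" where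
  "eval_magma g (Gen i) = g i"
| "eval_magma g (Node s t) = eval_magma g s \<cdot> eval_magma g t"

definition eval :: "('n \<Rightarrow> 'a) \<Rightarrow> ('n magma \<Rightarrow>\<^sub>0 'k) \<Rightarrow> 'a" where
  "eval g p = (\<Sum>m\<in>Poly_Mapping.keys p. Poly_Mapping.lookup p m \<odot> eval_magma g m)"

lemma eval_superset:
  "finite S \<Longrightarrow> Poly_Mapping.keys p \<subseteq> S \<Longrightarrow>
    eval g p = (\<Sum>m\<in>S. Poly_Mapping.lookup p m \<odot> eval_magma g m)"
  unfolding eval_def by (intro sum.mono_neutral_left) (auto simp: in_keys_iff)

lemma eval_add: "eval g (p + q) = eval g p + eval g q"
proof -
  let ?S = "Poly_Mapping.keys p \<union> Poly_Mapping.keys q"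
  have "Poly_Mapping.keys (p + q) \<subseteq> ?S" by (rule keys_add)
  then show ?thesis
    by (simp add: eval_superset[of ?S] lookup_add scale_left_distrib sum.distrib)
qed

lemma eval_scale: "eval g (pm_scale r p) = r \<odot> eval g p"
proof -
  have "Poly_Mapping.keys (pm_scale r p) \<subseteq> Poly_Mapping.keys p"
    by (auto simp: in_keys_iff)
  then show ?thesis
    by (simp add: eval_superset[of "Poly_Mapping.keys p"] scale_sum_right)
qed

lemma eval_zero [simp]: "eval g 0 = 0"
  by (simp add: eval_def)

lemma eval_sum: "eval g (\<Sum>i\<in>S. f i) = (\<Sum>i\<in>S. eval g (f i))"
  by (induction S rule: infinite_finite_induct) (auto simp: eval_add)

lemma eval_single: "eval g (Poly_Mapping.single m c) = c \<odot> eval_magma g m"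
  by (simp add: eval_superset[of "{m}"])

lemma eval_mult: "eval g (free_mult p q) = eval g p \<cdot> eval g q"
proof -
  let ?P = "Poly_Mapping.keys p" and ?Q = "Poly_Mapping.keys q"
  have "eval g p \<cdot> eval g q = (\<Sum>s\<in>?P. \<Sum>t\<in>?Q.
      (Poly_Mapping.lookup p s \<odot> eval_magma g s) \<cdot> (Poly_Mapping.lookup q t \<odot> eval_magma g t))"
    unfolding eval_def mult_sum_left by (simp only: mult_sum_right)
  then show ?thesis
    unfolding free_mult_def eval_sum eval_single
    by (simp add: mult_scale_left mult_scale_right mult.commute)
qed

lemma eval_diff: "eval g (p - q) = eval g p - eval g q"
  using eval_add[of g "p - q" q] by (simp add: algebra_simps)

end


section \<open>The free metabelian anticommutative algebra\<close>

definition verbal_ideal :: "('n magma \<Rightarrow>\<^sub>0 'k::field) set" where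
  "verbal_ideal = free.ideal_generated
     ({free_mult x x | x. True} \<union>
      {free_mult (free_mult x y) (free_mult z t) | x y z t. True})"

definition verbal_rel :: "('n magma \<Rightarrow>\<^sub>0 'k::field) \<Rightarrow> ('n magma \<Rightarrow>\<^sub>0 'k) \<Rightarrow> bool" where
  "verbal_rel p q \<longleftrightarrow> p - q \<in> verbal_ideal"

lemma alg_ideal_verbal_ideal: "free.alg_ideal verbal_ideal"
  unfolding verbal_ideal_def by (rule free.alg_ideal_ideal_generated)

lemma subspace_verbal_ideal: "free.subspace verbal_ideal"
  by (rule alg_ideal_verbal_ideal[unfolded free.alg_ideal_def, THEN conjunct1])

lemma verbal_ideal_mult:
  "b \<in> verbal_ideal \<Longrightarrow> free_mult a b \<in> verbal_ideal"
  "b \<in> verbal_ideal \<Longrightarrow> free_mult b a \<in> verbal_ideal"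
  using alg_ideal_verbal_ideal[unfolded free.alg_ideal_def, THEN conjunct2] by blast+

lemma equivp_verbal_rel: "equivp verbal_rel"
proof (intro equivpI reflpI sympI transpI)
  fix x y z :: "'n magma \<Rightarrow>\<^sub>0 'k::field"
  show "verbal_rel x x"
    by (simp add: verbal_rel_def free.subspace_0[OF subspace_verbal_ideal])
  show "verbal_rel y x" if "verbal_rel x y"
    using that free.subspace_neg[OF subspace_verbal_ideal] by (fastforce simp: verbal_rel_def)
  show "verbal_rel x z" if "verbal_rel x y" "verbal_rel y z"
    using that free.subspace_add[OF subspace_verbal_ideal, of "x - y" "y - z"]
    by (simp add: verbal_rel_def)
qed

quotient_type (overloaded) ('k, 'n) fma = "'n magma \<Rightarrow>\<^sub>0 'k::field" / verbal_rel
  by (rule equivp_verbal_rel)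

instantiation fma :: (field, type) "{ab_group_add, times}"
begin

lift_definition zero_fma :: "('a, 'b) fma" is 0 .

lift_definition plus_fma :: "('a, 'b) fma \<Rightarrow> ('a, 'b) fma \<Rightarrow> ('a, 'b) fma" is "(+)"
proof -
  fix p p' q q' :: "'b magma \<Rightarrow>\<^sub>0 'a"
  assume "verbal_rel p p'" "verbal_rel q q'"
  then show "verbal_rel (p + q) (p' + q')"
    using free.subspace_add[OF subspace_verbal_ideal, of "p - p'" "q - q'"]
    by (simp add: verbal_rel_def algebra_simps)
qed

lift_definition uminus_fma :: "('a, 'b) fma \<Rightarrow> ('a, 'b) fma" is uminus
proof -
  fix p p' :: "'b magma \<Rightarrow>\<^sub>0 'a"
  assume "verbal_rel p p'"
  then show "verbal_rel (- p) (- p')"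
    using free.subspace_neg[OF subspace_verbal_ideal, of "p - p'"]
    by (simp add: verbal_rel_def algebra_simps)
qed

lift_definition minus_fma :: "('a, 'b) fma \<Rightarrow> ('a, 'b) fma \<Rightarrow> ('a, 'b) fma" is "(-)"
proof -
  fix p p' q q' :: "'b magma \<Rightarrow>\<^sub>0 'a"
  assume "verbal_rel p p'" "verbal_rel q q'"
  then show "verbal_rel (p - q) (p' - q')"
    using free.subspace_diff[OF subspace_verbal_ideal, of "p - p'" "q - q'"]
    by (simp add: verbal_rel_def algebra_simps)
qed

lift_definition times_fma :: "('a, 'b) fma \<Rightarrow> ('a, 'b) fma \<Rightarrow> ('a, 'b) fma" is free_mult
proof -
  fix p p' q q' :: "'b magma \<Rightarrow>\<^sub>0 'a"
  assume "verbal_rel p p'" "verbal_rel q q'"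
  then have "free_mult (p - p') q + free_mult p' (q - q') \<in> verbal_ideal"
    by (intro free.subspace_add[OF subspace_verbal_ideal] verbal_ideal_mult)
       (auto simp: verbal_rel_def)
  then show "verbal_rel (free_mult p q) (free_mult p' q')"
    by (simp add: verbal_rel_def free.mult_diff_left free.mult_diff_right)
qed

instance
proof
  note r = equivp_reflp[OF equivp_verbal_rel]
  fix a b c :: "('a, 'b) fma"
  show "a + b + c = a + (b + c)" by transfer (simp add: r add.assoc)
  show "a + b = b + a" by transfer (simp add: r add.commute)
  show "0 + a = a" by transfer (simp add: r)
  show "- a + a = 0" by transfer (simp add: r)
  show "a - b = a + - b" by transfer (simp add: r)
qed

end

lift_definition fma_scale :: "'k::field \<Rightarrow> ('k, 'n) fma \<Rightarrow> ('k, 'n) fma" is pm_scale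
proof -
  fix r and p p' :: "'n magma \<Rightarrow>\<^sub>0 'k"
  assume "verbal_rel p p'"
  then show "verbal_rel (pm_scale r p) (pm_scale r p')"
    using free.subspace_scale[OF subspace_verbal_ideal, of "p - p'" r]
    by (simp add: verbal_rel_def free.scale_right_diff_distrib)
qed

lift_definition gen :: "'n \<Rightarrow> ('k::field, 'n) fma" is "\<lambda>i. Poly_Mapping.single (Gen i) 1" .

interpretation fma: nonassoc_algebra "fma_scale :: 'k::field \<Rightarrow> ('k, 'n) fma \<Rightarrow> _" "(*)"
proof
  note r = equivp_reflp[OF equivp_verbal_rel]
  fix a b c :: "('k, 'n) fma" and s t :: 'k
  show "fma_scale s (a + b) = fma_scale s a + fma_scale s b"
    by transfer (simp add: r free.scale_right_distrib)
  show "fma_scale (s + t) a = fma_scale s a + fma_scale t a"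
    by transfer (simp add: r free.scale_left_distrib)
  show "fma_scale s (fma_scale t a) = fma_scale (s * t) a"
    by transfer (simp add: r)
  show "fma_scale 1 a = a"
    by transfer (simp add: r)
  show "(a + b) * c = a * c + b * c"
    by transfer (simp add: r free.mult_add_left)
  show "a * (b + c) = a * b + a * c"
    by transfer (simp add: r free.mult_add_right)
  show "fma_scale s a * b = fma_scale s (a * b)"
    by transfer (simp add: r free.mult_scale_left)
  show "a * fma_scale s b = fma_scale s (a * b)"
    by transfer (simp add: r free.mult_scale_right)
qed

lemma anticommutative_fma:
  "nonassoc_algebra.anticommutative ((*) :: ('k::field, 'n) fma \<Rightarrow> _)"
proof -
  have "free_mult x x \<in> verbal_ideal" for x :: "'n magma \<Rightarrow>\<^sub>0 'k"
    unfolding verbal_ideal_def by (rule subsetD[OF free.ideal_generated_superset]) blast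
  then have "x * x = 0" for x :: "('k, 'n) fma"
    by transfer (simp add: verbal_rel_def)
  then show ?thesis
    by (simp add: fma.anticommutative_def)
qed

lemma metabelian_fma:
  "nonassoc_algebra.metabelian ((*) :: ('k::field, 'n) fma \<Rightarrow> _)"
proof -
  have "free_mult (free_mult x y) (free_mult z t) \<in> verbal_ideal"
    for x y z t :: "'n magma \<Rightarrow>\<^sub>0 'k"
    unfolding verbal_ideal_def by (rule subsetD[OF free.ideal_generated_superset]) blast
  then have "(x * y) * (z * t) = 0" for x y z t :: "('k, 'n) fma"
    by transfer (simp add: verbal_rel_def)
  then show ?thesis
    by (simp add: fma.metabelian_def)
qed

lemma (in nonassoc_algebra) eval_verbal_ideal:
  assumes "anticommutative" "metabelian" "p \<in> verbal_ideal"
  shows "eval g p = 0"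
proof -
  have "free.alg_ideal {p. eval g p = 0}"
    unfolding free.alg_ideal_def free.subspace_def
    by (auto simp: eval_add eval_scale eval_mult)
  moreover have "{free_mult x x | x. True} \<union>
      {free_mult (free_mult x y) (free_mult z t) | x y z t. True} \<subseteq> {p. eval g p = 0}"
    using assms(1,2) by (auto simp: eval_mult anticommutative_def metabelian_def)
  ultimately show ?thesis
    using free.ideal_generated_minimal assms(3) unfolding verbal_ideal_def by blast
qed

lemma (in nonassoc_algebra) eval_verbal_rel:
  assumes "anticommutative" "metabelian" "verbal_rel p q"
  shows "eval g p = eval g q"
  using eval_verbal_ideal[OF assms(1,2), of "p - q" g] assms(3)
  by (simp add: verbal_rel_def eval_diff)

lemma free_decompose:
  "p = (\<Sum>m\<in>Poly_Mapping.keys p. pm_scale (Poly_Mapping.lookup p m) (Poly_Mapping.single m 1))"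
  by (intro poly_mapping_eqI)
     (auto simp: lookup_sum pm_scale_single lookup_single when_def in_keys_iff)

lemma free_mult_single:
  "free_mult (Poly_Mapping.single s 1) (Poly_Mapping.single t 1) =
    (Poly_Mapping.single (Node s t) 1 :: 'n magma \<Rightarrow>\<^sub>0 'k::field)"
  by (simp add: free_mult_def)

theorem (in nonassoc_algebra) fma_universal_property:
  fixes g :: "'n \<Rightarrow> 'a"
  assumes "anticommutative" "metabelian"
  shows "\<exists>!h. alg_hom fma_scale (*) scale mult h \<and> (\<forall>i. h (gen i) = g i)"
proof (rule ex_ex1I)
  define h where "h a = eval g (rep_fma a)" for a :: "('k, 'n) fma"
  have h_abs: "h (abs_fma p) = eval g p" for p
    unfolding h_def
    by (rule eval_verbal_rel[OF assms])
       (metis Quotient3_fma Quotient3_rep_abs equivp_reflp equivp_verbal_rel)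
  have "h (a + b) = h a + h b" "h (fma_scale r a) = r \<odot> h a" "h (a * b) = h a \<cdot> h b" for a b r
    by (induction a rule: fma.abs_induct, induction b rule: fma.abs_induct;
        simp add: plus_fma.abs_eq fma_scale.abs_eq times_fma.abs_eq h_abs
          eval_add eval_scale eval_mult)+
  moreover have "h (gen i) = g i" for i
    by (simp add: gen.abs_eq h_abs eval_single)
  ultimately have "alg_hom fma_scale (*) scale mult h \<and> (\<forall>i. h (gen i) = g i)"
    by (simp add: alg_hom_def Vector_Spaces.linear_iff fma.vector_space_axioms
        vector_space_axioms)
  then show "\<exists>h. alg_hom fma_scale (*) scale mult h \<and> (\<forall>i. h (gen i) = g i)"
    by blast
next
  fix h h' :: "('k, 'n) fma \<Rightarrow> 'a"
  assume h: "alg_hom fma_scale (*) scale mult h \<and> (\<forall>i. h (gen i) = g i)"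
    and h': "alg_hom fma_scale (*) scale mult h' \<and> (\<forall>i. h' (gen i) = g i)"
  have eq: "f (abs_fma p) = eval g p"
    if f: "alg_hom fma_scale (*) scale mult f \<and> (\<forall>i. f (gen i) = g i)" for f p
  proof -
    have lin: "f (a + b) = f a + f b" "f (fma_scale r a) = r \<odot> f a" "f (a * b) = f a \<cdot> f b" for a b r
      using f by (auto simp: alg_hom_def Vector_Spaces.linear_iff)
    have "f 0 = 0" using lin(2)[of 0 0] by simp
    have single: "f (abs_fma (Poly_Mapping.single m 1)) = eval_magma g m" for m
    proof (induction m)
      case (Gen i)
      then show ?case using f by (simp add: gen.abs_eq[symmetric])
    next
      case (Node s t)
      then show ?case
        by (simp add: free_mult_single[symmetric] times_fma.abs_eq[symmetric] lin)
    qed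
    have sum: "f (abs_fma (\<Sum>i\<in>S. q i)) = (\<Sum>i\<in>S. f (abs_fma (q i)))"
      for S :: "'n magma set" and q
      by (induction S rule: infinite_finite_induct)
         (simp_all add: zero_fma_def[symmetric] \<open>f 0 = 0\<close> plus_fma.abs_eq[symmetric] lin)
    show ?thesis
      by (subst free_decompose)
         (simp add: sum fma_scale.abs_eq[symmetric] lin single eval_def)
  qed
  show "h = h'"
  proof
    fix a
    show "h a = h' a"
      by (induction a rule: fma.abs_induct) (simp add: eq[OF h] eq[OF h'])
  qed
qed


section \<open>Fox derivatives\<close>

text \<open>
  With words as a monoid under concatenation, \<open>'n list \<Rightarrow>\<^sub>0 'k\<close> is the monoid algebra of the free
  monoid on \<open>'n\<close>, that is, the free associative unital algebra \<open>U\<close> on \<open>'n\<close>.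
\<close>

instantiation list :: (type) monoid_add
begin

definition zero_list :: "'a list" where "zero_list = []"

definition plus_list :: "'a list \<Rightarrow> 'a list \<Rightarrow> 'a list" where "plus_list = (@)"

instance by standard (simp_all add: zero_list_def plus_list_def)

end

type_synonym ('k, 'n) free_assoc = "'n list \<Rightarrow>\<^sub>0 'k"

text \<open>
  \<open>Y\<close> is \<open>'k ^ 'n\<close> with basis \<open>y\<^sub>i = axis i 1\<close>, and \<open>T\<close> is the space of vectors over \<open>U\<close>,
  with basis \<open>t\<^sub>i = axis i 1\<close> and \<open>U\<close> acting from the right.
\<close>

type_synonym ('k, 'n) fox_space = "('k ^ 'n) \<times> (('k, 'n) free_assoc ^ 'n)"

definition U_gen :: "'n \<Rightarrow> ('k::field, 'n) free_assoc" where
  "U_gen i = Poly_Mapping.single [i] 1"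

definition R_op :: "'k::field ^ 'n \<Rightarrow> ('k, 'n) free_assoc" where
  "R_op a = (\<Sum>i\<in>UNIV. pm_scale (a $ i) (U_gen i))"

definition right_act ::
  "('k::field, 'n) free_assoc ^ 'n \<Rightarrow> ('k, 'n) free_assoc \<Rightarrow> ('k, 'n) free_assoc ^ 'n"
  where "right_act m u = (\<chi> i. m $ i * u)"

definition fox_scale :: "'k::field \<Rightarrow> ('k, 'n::finite) fox_space \<Rightarrow> ('k, 'n) fox_space" where
  "fox_scale c p = (c *s fst p, \<chi> i. pm_scale c (snd p $ i))"

definition fox_mult ::
  "('k::field, 'n::finite) fox_space \<Rightarrow> ('k, 'n) fox_space \<Rightarrow> ('k, 'n) fox_space" where
  "fox_mult p q = (0, right_act (snd p) (R_op (fst q)) - right_act (snd q) (R_op (fst p)))"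

lemma pm_scale_add_left: "pm_scale (r + s) p = pm_scale r p + pm_scale s p"
  by (rule vector_space.vector_space_assms(2)[OF vector_space_pm_scale])

lemma pm_scale_add_right: "pm_scale r (p + q) = pm_scale r p + pm_scale r q"
  by (rule vector_space.vector_space_assms(1)[OF vector_space_pm_scale])

lemma pm_scale_diff_right: "pm_scale r (p - q) = pm_scale r p - pm_scale r q"
  by (intro poly_mapping_eqI) (simp add: lookup_minus algebra_simps)

lemma pm_scale_pm_scale: "pm_scale r (pm_scale s p) = pm_scale (r * s) p"
  by (rule vector_space.vector_space_assms(3)[OF vector_space_pm_scale])

lemma pm_scale_one: "pm_scale 1 p = p"
  by (rule vector_space.vector_space_assms(4)[OF vector_space_pm_scale])

lemma pm_scale_mult_left:
  fixes u v :: "('k::field, 'n) free_assoc"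
  shows "pm_scale r u * v = pm_scale r (u * v)"
  by (simp add: pm_scale_def mult_map_scale_conv_mult mult.assoc)

lemma single_zero_commute:
  fixes u :: "('k::field, 'n) free_assoc"
  shows "u * Poly_Mapping.single 0 r = Poly_Mapping.single 0 r * u"
proof -
  have "u = (\<Sum>w\<in>Poly_Mapping.keys u. Poly_Mapping.single w (Poly_Mapping.lookup u w))"
    by (intro poly_mapping_eqI)
       (auto simp: lookup_sum lookup_single when_def in_keys_iff)
  then obtain c where u: "u = (\<Sum>w\<in>Poly_Mapping.keys u. Poly_Mapping.single w (c w))"
    by blast
  show ?thesis
    by (subst u, subst (2) u) (simp add: sum_distrib_left sum_distrib_right mult_single mult.commute)
qed

lemma pm_scale_mult_right:
  fixes u v :: "('k::field, 'n) free_assoc"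
  shows "u * pm_scale r v = pm_scale r (u * v)"
  by (simp add: pm_scale_def mult_map_scale_conv_mult mult.assoc[symmetric] single_zero_commute)

lemma R_op_add: "R_op (a + b) = R_op a + R_op b"
  by (simp add: R_op_def pm_scale_add_left sum.distrib)

lemma R_op_scale: "R_op (c *s a) = pm_scale c (R_op a)"
  by (simp add: R_op_def pm_scale_sum pm_scale_pm_scale)

interpretation fox: nonassoc_algebra
  "fox_scale :: 'k::field \<Rightarrow> ('k, 'n::finite) fox_space \<Rightarrow> _" fox_mult
  by unfold_locales
     (simp_all add: fox_scale_def fox_mult_def prod_eq_iff vec_eq_iff right_act_def R_op_add R_op_scale
        pm_scale_add_left pm_scale_add_right pm_scale_pm_scale pm_scale_one pm_scale_diff_right
        pm_scale_mult_left pm_scale_mult_right algebra_simps)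

lemma R_op_zero [simp]: "R_op 0 = 0"
  using R_op_add[of 0 0] by simp

lemma anticommutative_fox:
  "nonassoc_algebra.anticommutative (fox_mult :: ('k::field, 'n::finite) fox_space \<Rightarrow> _)"
  by (simp add: fox.anticommutative_def fox_mult_def zero_prod_def)

lemma metabelian_fox:
  "nonassoc_algebra.metabelian (fox_mult :: ('k::field, 'n::finite) fox_space \<Rightarrow> _)"
  by (simp add: fox.metabelian_def fox_mult_def zero_prod_def right_act_def vec_eq_iff)

lift_definition rho :: "('k::field, 'n::finite) fma \<Rightarrow> ('k, 'n) fox_space" is
  "fox.eval (\<lambda>i. (axis i 1, axis i 1))"
  by (rule fox.eval_verbal_rel[OF anticommutative_fox metabelian_fox])

lemma rho_gen: "rho (gen i) = (axis i 1, axis i 1)"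
  by transfer (simp add: fox.eval_single)

lemma alg_hom_rho:
  "alg_hom fma_scale (*) fox_scale fox_mult (rho :: ('k::field, 'n::finite) fma \<Rightarrow> _)"
proof -
  have "rho (a + b) = rho a + rho b" "rho (fma_scale r a) = fox_scale r (rho a)"
    "rho (a * b) = fox_mult (rho a) (rho b)" for a b :: "('k, 'n) fma" and r
    by (transfer; simp add: fox.eval_add fox.eval_scale fox.eval_mult)+
  then show ?thesis
    by (simp add: alg_hom_def Vector_Spaces.linear_iff fma.vector_space_axioms
        fox.vector_space_axioms)
qed

definition fox_deriv :: "'n::finite \<Rightarrow> ('k::field, 'n) fma \<Rightarrow> ('k, 'n) free_assoc" where
  "fox_deriv i a = snd (rho a) $ i"

end

theory Submission
  imports Defs
begin

text \<open>
  Fix a generator \<open>x\<^sub>o\<close> and let \<open>\<phi> : U \<rightarrow> A\<close> be the linear map sending a word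
  \<open>z\<^sub>k \<dots> z\<^sub>l\<close> to the left-normed product \<open>(\<dots>(x\<^sub>o x\<^sub>k)\<dots>) x\<^sub>l\<close>. It is a one-sided inverse of
  \<open>\<partial>/\<partial>x\<^sub>o\<close> modulo the ideal \<open>I\<close> generated by the products of the other generators:
  \<open>f - \<phi> (\<partial>f/\<partial>x\<^sub>o) \<in> I\<close> for every \<open>f \<in> A\<^sup>2\<close>. Hence \<open>\<partial>f/\<partial>x\<^sub>o = 0\<close> forces \<open>f \<in> I\<close>.
  Conversely, the elements of \<open>A\<^sup>2\<close> killed by \<open>\<partial>/\<partial>x\<^sub>o\<close> form an ideal containing the generators of \<open>I\<close>.
\<close>

section \<open>Linearity and the product rule of Fox derivatives\<close>

lemma rho_add: "rho (a + b) = rho a + rho b"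
  and rho_scale: "rho (fma_scale r a) = fox_scale r (rho a)"
  and rho_mult: "rho (a * b) = fox_mult (rho a) (rho b)"
  using alg_hom_rho by (auto simp: alg_hom_def Vector_Spaces.linear_iff)

lemma rho_zero [simp]: "rho 0 = 0"
  using rho_add[of 0 0] by simp

lemma R_op_axis: "R_op (axis k 1) = U_gen k"
  by (intro poly_mapping_eqI) (simp add: R_op_def lookup_sum axis_def if_distrib if_distribR cong: if_cong)

lemma pm_scale_zero [simp]: "pm_scale r 0 = 0"
  by (intro poly_mapping_eqI) simp

lemma fox_deriv_add: "fox_deriv i (a + b) = fox_deriv i a + fox_deriv i b"
  by (simp add: fox_deriv_def rho_add)

lemma fox_deriv_scale: "fox_deriv i (fma_scale r a) = pm_scale r (fox_deriv i a)"
  by (simp add: fox_deriv_def rho_scale fox_scale_def)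

lemma fox_deriv_zero [simp]: "fox_deriv i 0 = 0"
  using fox_deriv_add[of i 0 0] by simp

lemma fox_deriv_gen: "fox_deriv i (gen j) = (if i = j then 1 else 0)"
  by (simp add: fox_deriv_def rho_gen axis_def)

lemma fox_deriv_mult:
  "fox_deriv i (a * b) =
    fox_deriv i a * R_op (fst (rho b)) - fox_deriv i b * R_op (fst (rho a))"
  by (simp add: fox_deriv_def rho_mult fox_mult_def right_act_def)

section \<open>The square \<open>A\<^sup>2\<close>\<close>

lemma subspace_square: "fma.subspace fma.square"
  by (simp add: fma.square_def)

lemma mult_in_square: "a * b \<in> fma.square"
  unfolding fma.square_def by (rule fma.span_base) blast

lemma fst_rho_square:
  assumes "f \<in> fma.square"
  shows "fst (rho f) = 0"
  using assms unfolding fma.square_def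
proof (induction rule: fma.span_induct_alt)
  case base
  show ?case by simp
next
  case (step c x y)
  then show ?case
    by (auto simp: rho_add rho_scale rho_mult fox_mult_def fox_scale_def)
qed

lemma square_mult_product: "f \<in> fma.square \<Longrightarrow> f * (a * b) = 0"
  unfolding fma.square_def
proof (induction rule: fma.span_induct_alt)
  case (step c x y)
  then show ?case
    using metabelian_fma
    by (auto simp: fma.mult_add_left fma.mult_scale_left fma.metabelian_def)
qed simp

text \<open>An element of \<open>A\<^sup>2\<close> has no \<open>Y\<close>-component, so the second
  term of the product rule vanishes. \<open>left_normed_map_mult_gen\<close> is the matching rule
  for \<open>\<phi>\<close>.\<close>

lemma fox_deriv_square_mult_gen:
  "f \<in> fma.square \<Longrightarrow> fox_deriv i (f * gen k) = fox_deriv i f * U_gen k"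
  by (simp add: fox_deriv_mult fst_rho_square rho_gen R_op_axis)

section \<open>Anticommutativity and spanning by monomials\<close>

lemma fma_mult_self: "a * a = (0 :: ('k::field, 'n) fma)"
  using anticommutative_fma by (auto simp: fma.anticommutative_def)

lemma fma_mult_add_swap: "a * b + b * a = (0 :: ('k::field, 'n) fma)"
  using fma_mult_self[of "a + b", unfolded fma.mult_add_left fma.mult_add_right]
  by (simp add: fma_mult_self add.commute)

lemma fma_mult_swap: "a * b = - (b * a :: ('k::field, 'n) fma)"
  using fma_mult_add_swap[of a b] by (simp add: eq_neg_iff_add_eq_0)

lemma span_monomials: "a \<in> fma.span (range (fma.eval_magma gen))"
proof (induction a rule: fma.abs_induct)
  case (1 p)
  have "abs_fma (Poly_Mapping.single m 1) = (fma.eval_magma gen m :: ('a, 'b) fma)" for m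
    by (induction m)
       (simp_all add: gen.abs_eq free_mult_single[symmetric] times_fma.abs_eq[symmetric])
  then have "abs_fma (Poly_Mapping.single m c) = fma_scale c (fma.eval_magma gen m :: ('a, 'b) fma)"
    for m c
    using fma_scale.abs_eq[of c "Poly_Mapping.single m 1"] by (simp add: pm_scale_single)
  then have single: "abs_fma (Poly_Mapping.single m c) \<in>
      fma.span (range (fma.eval_magma gen :: _ \<Rightarrow> ('a, 'b) fma))" for m c
    by (simp add: fma.span_scale fma.span_base)
  have "abs_fma (\<Sum>m\<in>S. Poly_Mapping.single m (c m)) \<in>
      fma.span (range (fma.eval_magma gen :: _ \<Rightarrow> ('a, 'b) fma))" for S and c :: "'b magma \<Rightarrow> 'a"
    by (induction S rule: infinite_finite_induct)
       (auto simp: zero_fma_def[symmetric] plus_fma.abs_eq[symmetric]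
          intro: fma.span_zero fma.span_add single)
  then show ?case
    by (subst free_decompose) (simp add: pm_scale_single)
qed

section \<open>The map \<open>\<phi>\<close> from words to left-normed products\<close>

definition left_normed :: "'n \<Rightarrow> 'n list \<Rightarrow> ('k::field, 'n) fma" where
  "left_normed i w = foldl (\<lambda>a k. a * gen k) (gen i) w"

definition left_normed_map :: "'n \<Rightarrow> ('k::field, 'n) free_assoc \<Rightarrow> ('k, 'n) fma" where
  "left_normed_map i u =
    (\<Sum>w\<in>Poly_Mapping.keys u. fma_scale (Poly_Mapping.lookup u w) (left_normed i w))"

lemma left_normed_map_superset:
  "finite S \<Longrightarrow> Poly_Mapping.keys u \<subseteq> S \<Longrightarrow>
    left_normed_map i u = (\<Sum>w\<in>S. fma_scale (Poly_Mapping.lookup u w) (left_normed i w))"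
  unfolding left_normed_map_def by (intro sum.mono_neutral_left) (auto simp: in_keys_iff)

lemma left_normed_map_zero [simp]: "left_normed_map i 0 = 0"
  by (simp add: left_normed_map_def)

lemma left_normed_map_add: "left_normed_map i (u + v) = left_normed_map i u + left_normed_map i v"
proof -
  let ?S = "Poly_Mapping.keys u \<union> Poly_Mapping.keys v"
  have "Poly_Mapping.keys (u + v) \<subseteq> ?S" by (rule keys_add)
  then show ?thesis
    by (simp add: left_normed_map_superset[of ?S] lookup_add fma.scale_left_distrib sum.distrib)
qed

lemma left_normed_map_scale: "left_normed_map i (pm_scale r u) = fma_scale r (left_normed_map i u)"
proof -
  have "Poly_Mapping.keys (pm_scale r u) \<subseteq> Poly_Mapping.keys u"
    by (auto simp: in_keys_iff)
  then show ?thesis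
    by (simp add: left_normed_map_superset[of "Poly_Mapping.keys u"] fma.scale_sum_right)
qed

lemma left_normed_map_single:
  "left_normed_map i (Poly_Mapping.single w c) = fma_scale c (left_normed i w)"
  by (simp add: left_normed_map_superset[of "{w}"])

lemma left_normed_map_sum: "left_normed_map i (\<Sum>x\<in>S. u x) = (\<Sum>x\<in>S. left_normed_map i (u x))"
  by (induction S rule: infinite_finite_induct) (simp_all add: left_normed_map_add)

text \<open>Right multiplication by \<open>U_gen k\<close> appends the letter \<open>k\<close> to
  each word, which adds one last factor \<open>gen k\<close> to the left-normed product.\<close>

lemma left_normed_map_mult_gen:
  fixes u :: "('k::field, 'n) free_assoc"
  shows "left_normed_map i (u * U_gen k) = left_normed_map i u * gen k"
proof -
  have u: "u = (\<Sum>w\<in>Poly_Mapping.keys u. Poly_Mapping.single w (Poly_Mapping.lookup u w))"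
    by (intro poly_mapping_eqI)
       (auto simp: lookup_sum lookup_single when_def in_keys_iff)
  have "u * U_gen k =
      (\<Sum>w\<in>Poly_Mapping.keys u. Poly_Mapping.single (w @ [k]) (Poly_Mapping.lookup u w))"
    by (subst u) (simp add: sum_distrib_right U_gen_def mult_single plus_list_def)
  then show ?thesis
    by (simp add: left_normed_map_sum left_normed_map_single left_normed_def
        left_normed_map_def[of i u] fma.mult_sum_left fma.mult_scale_left)
qed

lemma left_normed_map_one: "left_normed_map i 1 = gen i"
  by (simp add: single_one[symmetric] left_normed_map_single left_normed_def zero_list_def
      del: single_one)

lemma left_normed_map_U_gen: "left_normed_map i (U_gen k) = gen i * gen k"
  using left_normed_map_mult_gen[of i 1 k] by (simp add: left_normed_map_one)

lemma left_normed_map_neg: "left_normed_map i (- u) = - left_normed_map i u"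
  using left_normed_map_add[of i u "- u"] by (simp add: eq_neg_iff_add_eq_0 add.commute)

section \<open>Recovering elements of \<open>A\<^sup>2\<close> modulo the ideal
  \<open>I\<close>\<close>

definition other_ideal :: "'n \<Rightarrow> ('k::field, 'n) fma set" where
  "other_ideal l = fma.ideal_generated {gen i * gen j | i j. i \<noteq> l \<and> j \<noteq> l}"

lemma alg_ideal_other_ideal: "fma.alg_ideal (other_ideal i)"
  unfolding other_ideal_def by (rule fma.alg_ideal_ideal_generated)

lemma subspace_other_ideal: "fma.subspace (other_ideal i)"
  using alg_ideal_other_ideal[of i] by (auto simp: fma.alg_ideal_def)

lemma other_ideal_mult: "b \<in> other_ideal i \<Longrightarrow> b * a \<in> other_ideal i"
  using alg_ideal_other_ideal[of i] by (auto simp: fma.alg_ideal_def)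

lemma gen_mult_gen_in_other_ideal: "i \<noteq> l \<Longrightarrow> j \<noteq> l \<Longrightarrow> gen i * gen j \<in> other_ideal l"
  unfolding other_ideal_def by (rule subsetD[OF fma.ideal_generated_superset]) blast

text \<open>Membership in \<open>A\<^sup>2\<close> is included so that
  \<open>fox_deriv_square_mult_gen\<close> and \<open>square_mult_product\<close> apply to every
  element of the set.\<close>

definition recoverable :: "'n::finite \<Rightarrow> ('k::field, 'n) fma set" where
  "recoverable i = {f \<in> fma.square. f - left_normed_map i (fox_deriv i f) \<in> other_ideal i}"

lemma subspace_recoverable: "fma.subspace (recoverable i)"
proof (rule fma.subspaceI)
  show "0 \<in> recoverable i"
    by (simp add: recoverable_def fma.subspace_0 subspace_square subspace_other_ideal)
next
  fix f g :: "('a, 'b) fma"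
  assume "f \<in> recoverable i" "g \<in> recoverable i"
  then show "f + g \<in> recoverable i"
    using fma.subspace_add[OF subspace_other_ideal, of "f - left_normed_map i (fox_deriv i f)" i
        "g - left_normed_map i (fox_deriv i g)"]
    by (simp add: recoverable_def fma.subspace_add subspace_square fox_deriv_add
        left_normed_map_add algebra_simps)
next
  fix r :: 'a and f :: "('a, 'b) fma"
  assume "f \<in> recoverable i"
  then show "fma_scale r f \<in> recoverable i"
    using fma.subspace_scale[OF subspace_other_ideal, of "f - left_normed_map i (fox_deriv i f)" i r]
    by (simp add: recoverable_def fma.subspace_scale subspace_square fox_deriv_scale
        left_normed_map_scale fma.scale_right_diff_distrib)
qed

text \<open>For a generator, \<open>\<partial>/\<partial>x\<^sub>i\<close> and \<open>\<phi>\<close>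
  both respect the right multiplication, so the error
  \<open>f - \<phi> (\<partial>f/\<partial>x\<^sub>i)\<close> is just multiplied by
  \<open>gen k\<close> and stays in the ideal. For a composite monomial the product is 0 by
  metabelianity.\<close>

lemma recoverable_mult_monomial:
  assumes "f \<in> recoverable i"
  shows "f * fma.eval_magma gen m \<in> recoverable i"
proof (cases m)
  case (Gen k)
  then show ?thesis
    using assms other_ideal_mult[of "f - left_normed_map i (fox_deriv i f)" i "gen k"]
    by (simp add: recoverable_def mult_in_square fox_deriv_square_mult_gen
        left_normed_map_mult_gen fma.mult_diff_left)
next
  case (Node s t)
  then show ?thesis
    using assms fma.subspace_0[OF subspace_recoverable]
    by (simp add: recoverable_def square_mult_product)
qed

lemma recoverable_gen_mult_gen: "gen j * gen k \<in> recoverable i"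
proof -
  have deriv: "fox_deriv i (gen j * gen k :: ('a, 'b) fma) =
      (if i = j then U_gen k else 0) - (if i = k then U_gen j else 0)"
    by (simp add: fox_deriv_mult fox_deriv_gen rho_gen R_op_axis)
  \<comment> \<open>If exactly one of \<open>j\<close>, \<open>k\<close> is \<open>i\<close>, then
    \<open>\<phi>\<close> returns the product itself, by anticommutativity when
    \<open>k = i\<close>. If both are, product and derivative are 0. If neither is, the derivative
    is 0 and the product is a generator of the ideal.\<close>
  show ?thesis
    using fma.subspace_0[OF subspace_other_ideal, of i] gen_mult_gen_in_other_ideal[of j i k]
    by (auto simp: recoverable_def mult_in_square deriv left_normed_map_U_gen left_normed_map_neg
        fma_mult_self fma_mult_add_swap)
qed

text \<open>A composite factor is recoverable by induction, and multiplying it on the right by the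
  other factor keeps it so. If only the right factor is composite, anticommutativity swaps the two
  at the cost of a sign.\<close>

lemma recoverable_monomial: "(fma.eval_magma gen (Node s t) :: ('k::field, 'n::finite) fma) \<in> recoverable i"
proof (induction "Node s t" arbitrary: s t rule: measure_induct_rule[where f = size])
  case less
  show ?case
  proof (cases s)
    case (Node s1 s2)
    with less[of s1 s2] recoverable_mult_monomial[of "fma.eval_magma gen s" i t] show ?thesis
      by simp
  next
    case s: (Gen j)
    show ?thesis
    proof (cases t)
      case (Gen k)
      with s show ?thesis by (simp add: recoverable_gen_mult_gen)
    next
      case (Node t1 t2)
      with less[of t1 t2] recoverable_mult_monomial[of "fma.eval_magma gen t" i s]
      have "(fma.eval_magma gen t * fma.eval_magma gen s :: ('k, 'n) fma) \<in> recoverable i" by simp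
      from fma.subspace_neg[OF subspace_recoverable this] show ?thesis
        by (simp add: fma_mult_swap[of "fma.eval_magma gen s"])
    qed
  qed
qed

lemma square_subset_recoverable: "fma.square \<subseteq> recoverable i"
proof -
  \<comment> \<open>Bilinear expansion in two rounds: first the right factor against a fixed
    monomial, then the left factor.\<close>
  have mono: "fma.eval_magma gen s * b \<in> recoverable i" for s and b :: "('a, 'b) fma"
    using span_monomials[of b]
  proof (induction rule: fma.span_induct_alt)
    case base
    then show ?case by (simp add: fma.subspace_0[OF subspace_recoverable])
  next
    case (step c x y)
    then show ?case
      using recoverable_monomial[of s _ i]
      by (auto simp: fma.mult_add_right fma.mult_scale_right
          intro!: fma.subspace_add[OF subspace_recoverable] fma.subspace_scale[OF subspace_recoverable])
  qed
  have "a * b \<in> recoverable i" for a b :: "('a, 'b) fma"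
    using span_monomials[of a]
  proof (induction rule: fma.span_induct_alt)
    case base
    then show ?case by (simp add: fma.subspace_0[OF subspace_recoverable])
  next
    case (step c x y)
    then show ?case
      using mono
      by (auto simp: fma.mult_add_left fma.mult_scale_left
          intro!: fma.subspace_add[OF subspace_recoverable] fma.subspace_scale[OF subspace_recoverable])
  qed
  then show ?thesis
    unfolding fma.square_def by (intro fma.span_minimal subspace_recoverable) auto
qed

section \<open>The converse inclusion and the equivalence\<close>

lemma other_ideal_subset_fox_deriv_kernel:
  "other_ideal i \<subseteq> {f \<in> fma.square. fox_deriv i f = 0}"
  unfolding other_ideal_def
proof (rule fma.ideal_generated_minimal)
  \<comment> \<open>For \<open>f\<close> in this set and any \<open>a\<close>, one term of the
    product rule vanishes since \<open>\<partial>f/\<partial>x\<^sub>i = 0\<close>, the other since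
    \<open>f\<close> has no \<open>Y\<close>-component. The restriction to \<open>A\<^sup>2\<close>
    matters: for \<open>j \<noteq> i\<close> the generator \<open>gen j\<close> has derivative 0,
    but \<open>gen i * gen j\<close> has derivative \<open>U_gen j\<close>.\<close>
  show "fma.alg_ideal {f \<in> fma.square. fox_deriv i f = 0}"
    unfolding fma.alg_ideal_def fma.subspace_def
    by (auto simp: fma.subspace_0 fma.subspace_add fma.subspace_scale subspace_square
        fox_deriv_add fox_deriv_scale fox_deriv_mult mult_in_square fst_rho_square)
qed (auto simp: mult_in_square fox_deriv_mult fox_deriv_gen)

theorem fox_deriv_eq_0_iff:
  assumes "f \<in> fma.square"
  shows "fox_deriv i f = 0 \<longleftrightarrow> f \<in> other_ideal i"
  using assms square_subset_recoverable[of i] other_ideal_subset_fox_deriv_kernel[of i]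
  by (auto simp: recoverable_def)

theorem lemma4:
  fixes f :: "('k::field, 'n::finite) fma"
    and idx :: "nat \<Rightarrow> 'n"
  assumes "bij_betw idx {1..CARD('n)} UNIV"
    and "f \<in> fma.square"
  shows "fox_deriv (idx 1) f = 0 \<longleftrightarrow>
    f \<in> fma.ideal_generated
      {gen (idx i) * gen (idx j) | i j.
        i \<in> {1..CARD('n)} \<and> j \<in> {1..CARD('n)} \<and> i > 1 \<and> j > 1}"
proof -
  have "1 \<in> {1..CARD('n)}" by (simp add: Suc_leI)
  \<comment> \<open>Surjectivity of the enumeration supplies the index of \<open>k\<close>;
    injectivity, with 1 itself a valid index, makes "index above 1" the same as "different from
    \<open>idx 1\<close>".\<close>
  then have idx: "k \<noteq> idx 1 \<longleftrightarrow> (\<exists>i \<in> {1..CARD('n)}. i > 1 \<and> k = idx i)" for k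
    using assms(1) unfolding bij_betw_def inj_on_def
    by (metis UNIV_I atLeastAtMost_iff image_iff le_neq_implies_less less_irrefl)
  have "{gen i * gen j | i j. i \<noteq> idx 1 \<and> j \<noteq> idx 1} =
      {gen (idx i) * gen (idx j) :: ('k, 'n) fma | i j.
        i \<in> {1..CARD('n)} \<and> j \<in> {1..CARD('n)} \<and> i > 1 \<and> j > 1}"
    unfolding idx by blast
  then show ?thesis
    using fox_deriv_eq_0_iff[OF assms(2), of "idx 1"] by (simp add: other_ideal_def)
qed

end
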